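(* Let $I\subset\mathbb R$ be an interval, $\theta\in\mathbb R$, and let $(\gamma_h,\gamma_h^d):I\to\Delta_1$ be a spacelike Legendre curve with $\gamma_h^s=\gamma_h\wedge\gamma_h^d$. Let $HP_\theta=\cosh\theta\,\gamma_h+\sinh\theta\,\gamma_h^d$ and $DP_\theta=\sinh\theta\,\gamma_h+\cosh\theta\,\gamma_h^d$ be the hyperbolic and de Sitter parallels of $(\gamma_h,\gamma_h^d)$, and let $\mu_P=HP_\theta\wedge DP_\theta$. Then, at every $t\in I$, $$(HP_\theta,DP_\theta,\mu_P)^T=B_1(\theta)\,(\gamma_h,\gamma_h^d,\gamma_h^s)^T .$$
   Context: All maps are $C^\infty$. $\mathbb R^3_1$ is $\mathbb R^3$ with $\langle x,y\rangle=-x_1y_1+x_2y_2+x_3y_3$ and $x\wedge y=(-(x_2y_3-x_3y_2),\,x_3y_1-x_1y_3,\,x_1y_2-x_2y_1)$. $H^2=\{x:\langle x,x\rangle=-1\}$, $S^2_1=\{x:\langle x,x\rangle=1\}$, $\Delta_1=\{(v,w)\in H^2\times S_1^2:\langle v,w\rangle=0\}$. A spacelike Legendre curve in $\Delta_1$ is a smooth map $(\gamma_h,\gamma_h^d):I\to\Delta_1$ with $\langle\dot\gamma_h,\gamma_h^d\rangle=0$ on $I$. Matrix: $B_1(\phi)=\begin{pmatrix}\cosh\phi&\sinh\phi&0\\ \sinh\phi&\cosh\phi&0\\0&0&1\end{pmatrix}$. For a $3\times3$ matrix $A=(a_{ij})$ and vectors $v_1,v_2,v_3$, $A(v_1,v_2,v_3)^T$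 denotes the triple whose $i$-th entry is $\sum_j a_{ij}v_j$. *)

theory Defs
  imports "HOL-Analysis.Analysis"
begin

definition lorentz_inner :: "real^3 \<Rightarrow> real^3 \<Rightarrow> real" where
  "lorentz_inner x y = - (x$1 * y$1) + x$2 * y$2 + x$3 * y$3"

definition lorentz_wedge :: "real^3 \<Rightarrow> real^3 \<Rightarrow> real^3" where
  "lorentz_wedge x y =
     vector [- (x$2 * y$3 - x$3 * y$2), x$3 * y$1 - x$1 * y$3, x$1 * y$2 - x$2 * y$1]"

text \<open>Both sheets of the hyperboloid are included.\<close>
definition hyperbolic_plane :: "(real^3) set" where
  "hyperbolic_plane = {x. lorentz_inner x x = - 1}"

definition de_sitter_space :: "(real^3) set" where
  "de_sitter_space = {x. lorentz_inner x x = 1}"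

definition Delta1 :: "((real^3) \<times> (real^3)) set" where
  "Delta1 = {(v, w). v \<in> hyperbolic_plane \<and> w \<in> de_sitter_space \<and> lorentz_inner v w = 0}"

text \<open>
  \<open>C\<^sup>\<infinity>\<close> on an interval, expressed by a sequence \<open>D\<close> of successive derivatives.
  Derivatives are taken within the interval, hence are one-sided at any end point
  that belongs to it.
\<close>
definition smooth_on :: "real set \<Rightarrow> (real \<Rightarrow> 'a::real_normed_vector) \<Rightarrow> bool" where
  "smooth_on I f \<longleftrightarrow>
     (\<exists>D. (\<forall>t\<in>I. D 0 t = f t) \<and>
          (\<forall>n. \<forall>t\<in>I. (D n has_vector_derivative D (Suc n) t) (at t within I)))"

text \<open>
  The vector \<open>v\<close> below is the velocity of \<open>gh\<close> at \<open>t\<close>; it is unique unless \<open>I\<close> is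
  a single point, in which case the velocity condition is vacuous.
\<close>
definition spacelike_Legendre_curve ::
    "real set \<Rightarrow> (real \<Rightarrow> real^3) \<Rightarrow> (real \<Rightarrow> real^3) \<Rightarrow> bool" where
  "spacelike_Legendre_curve I gh gd \<longleftrightarrow>
     smooth_on I (\<lambda>t. (gh t, gd t)) \<and>
     (\<forall>t\<in>I. (gh t, gd t) \<in> Delta1) \<and>
     (\<forall>t\<in>I. \<exists>v. (gh has_vector_derivative v) (at t within I) \<and> lorentz_inner v (gd t) = 0)"

definition hyperbolic_parallel ::
    "real \<Rightarrow> (real \<Rightarrow> real^3) \<Rightarrow> (real \<Rightarrow> real^3) \<Rightarrow> real \<Rightarrow> real^3" where
  "hyperbolic_parallel \<theta> gh gd t = cosh \<theta> *\<^sub>R gh t + sinh \<theta> *\<^sub>R gd t"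

definition de_sitter_parallel ::
    "real \<Rightarrow> (real \<Rightarrow> real^3) \<Rightarrow> (real \<Rightarrow> real^3) \<Rightarrow> real \<Rightarrow> real^3" where
  "de_sitter_parallel \<theta> gh gd t = sinh \<theta> *\<^sub>R gh t + cosh \<theta> *\<^sub>R gd t"

definition B1 :: "real \<Rightarrow> real^3^3" where
  "B1 \<phi> = vector [vector [cosh \<phi>, sinh \<phi>, 0],
                  vector [sinh \<phi>, cosh \<phi>, 0],
                  vector [0, 0, 1]]"

text \<open>A triple of vectors has type \<open>(real^3)^3\<close>, with \<open>v $ j\<close> its \<open>j\<close>-th member.\<close>
definition matrix_on_triple :: "real^3^3 \<Rightarrow> (real^3)^3 \<Rightarrow> (real^3)^3" where
  "matrix_on_triple A v = (\<chi> i. \<Sum>j\<in>UNIV. A $ i $ j *\<^sub>R v $ j)"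

end

theory Submission
  imports Defs
begin

text \<open>
  The first two rows of the identity are the definitions of the two parallels.
  The third row is the invariance of the Lorentzian wedge under hyperbolic rotation:
  the wedge is bilinear and alternating, so a linear change of two vectors multiplies
  their wedge by the determinant of the change, and here this determinant is
  \<open>cosh\<^sup>2 \<theta> - sinh\<^sup>2 \<theta> = 1\<close>.
\<close>

text \<open>
  Each component of the wedge is, up to sign, a two-by-two minor of the matrix with rows
  \<open>x\<close> and \<open>y\<close>, and minors are multiplicative under row operations.
\<close>

lemma lorentz_wedge_linear_combinations:
  "lorentz_wedge (a *\<^sub>R x + b *\<^sub>R y) (c *\<^sub>R x + d *\<^sub>R y) =
     (a * d - b * c) *\<^sub>R lorentz_wedge x y"
  by (simp add: lorentz_wedge_def vec_eq_iff forall_3 algebra_simps)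

lemma lorentz_wedge_parallels:
  "lorentz_wedge (hyperbolic_parallel \<theta> gh gd t) (de_sitter_parallel \<theta> gh gd t) =
     lorentz_wedge (gh t) (gd t)"
proof -
  have "cosh \<theta> * cosh \<theta> - sinh \<theta> * sinh \<theta> = 1"
    using hyperbolic_pythagoras[of \<theta>] by (simp add: power2_eq_square)
  then show ?thesis
    by (simp add: hyperbolic_parallel_def de_sitter_parallel_def
        lorentz_wedge_linear_combinations)
qed

lemma matrix_on_triple_B1:
  "matrix_on_triple (B1 \<phi>) (vector [u, v, w]) =
     vector [cosh \<phi> *\<^sub>R u + sinh \<phi> *\<^sub>R v, sinh \<phi> *\<^sub>R u + cosh \<phi> *\<^sub>R v, w]"
  unfolding vec_eq_iff[of "matrix_on_triple _ _"]
  by (simp add: matrix_on_triple_def B1_def forall_3 sum_3)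

theorem proposition3p31:
  fixes I :: "real set" and \<theta> :: real
    and gh gd gs HP DP muP :: "real \<Rightarrow> real^3"
  assumes "is_interval I"
    and "spacelike_Legendre_curve I gh gd"
    and "\<And>t. t \<in> I \<Longrightarrow> gs t = lorentz_wedge (gh t) (gd t)"
    and "\<And>t. t \<in> I \<Longrightarrow> HP t = hyperbolic_parallel \<theta> gh gd t"
    and "\<And>t. t \<in> I \<Longrightarrow> DP t = de_sitter_parallel \<theta> gh gd t"
    and "\<And>t. t \<in> I \<Longrightarrow> muP t = lorentz_wedge (HP t) (DP t)"
  shows "\<forall>t\<in>I. (vector [HP t, DP t, muP t] :: (real^3)^3) =
           matrix_on_triple (B1 \<theta>) (vector [gh t, gd t, gs t])"
proof
  fix t assume "t \<in> I"
  have "muP t = gs t"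
    using assms(3-6)[OF \<open>t \<in> I\<close>] by (simp add: lorentz_wedge_parallels)
  then show "(vector [HP t, DP t, muP t] :: (real^3)^3) =
      matrix_on_triple (B1 \<theta>) (vector [gh t, gd t, gs t])"
    using assms(4,5)[OF \<open>t \<in> I\<close>]
    by (simp add: matrix_on_triple_B1 hyperbolic_parallel_def de_sitter_parallel_def)
qed

end
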